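(* Let $r=\frac{e^2-1}{e^2+1}$ and let $\mathcal{F}=\alpha_F+\beta_F$ be the Funk–Finsler metric on $\mathbb{D}_K(1)=\{x\in\mathbb{R}^2:|x|<r\}$. Define $$\phi=\frac{(1-r^2)\big[(1-|x|^2)|\xi|^2+2\langle x,\xi\rangle^2\big]}{(r^2-|x|^2)(1-|x|^2)^2},$$ $$\psi=\frac{2(1-r^2)\langle x,\xi\rangle}{(1-|x|^2)^3(r^2-|x|^2)^2}\Big[(1-|x|^2)|\xi|^2(3r^2-2|x|^2-1)-2\langle x,\xi\rangle^2(1+|x|^2-2r^2)\Big],$$ $$\tau_k=\frac{(1-r^2)\big(x^k|\xi|^2-\xi^k\langle x,\xi\rangle\big)}{\mathcal{F}(r^2-|x|^2)^2(1-|x|^2)}.$$ Then the Riemann curvature of $\mathcal{F}$ is $$R^i_k=-\big(\delta^i_k\alpha_F^2-\alpha_F(\alpha_F)_{\xi^k}\xi^i\big)+\Big[3\Big(\frac{\phi}{2\mathcal{F}}\Big)^2-\frac{\psi}{2\mathcal{F}}\Big]\Big(\delta^i_k-\frac{\mathcal{F}_{\xi^k}}{\mathcal{F}}\xi^i\Big)+\tau_k\xi^i,$$ and the Ricci curvature $\mathrm{Ric}=R^i_i$ and flag curvature $\mathbf{K}$ satisfy $$\mathrm{Ric}=\mathbf{K}\,\mathcal{F}^2=3\Big(\frac{\phi}{2\mathcal{F}}\Big)^2-\frac{\psi}{2\mathcal{F}}-\alpha_F^2.$$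
   Context: $\alpha_F(x,\xi)=\frac{\sqrt{(r^2-|x|^2)|\xi|^2+\langle x,\xi\rangle^2}}{r^2-|x|^2}$, $\beta_F(x,\xi)=\frac{(1-r^2)\langle x,\xi\rangle}{(r^2-|x|^2)(1-|x|^2)}$, $\mathcal{F}=\alpha_F+\beta_F$; subscripts $\xi^k$ denote partial derivatives in $\xi^k$. Spray coefficients: $G^i=\frac14g^{i\ell}\{[F^2]_{x^k\xi^\ell}\xi^k-[F^2]_{x^\ell}\}$ with $g_{ij}=\frac12\partial_{\xi^i}\partial_{\xi^j}F^2$. Riemann curvature: $R^i_k=2\frac{\partial G^i}{\partial x^k}-\xi^j\frac{\partial^2G^i}{\partial x^j\partial\xi^k}+2G^j\frac{\partial^2G^i}{\partial\xi^j\partial\xi^k}-\frac{\partial G^i}{\partial\xi^j}\frac{\partial G^j}{\partial\xi^k}$. Ricci curvature $\mathrm{Ric}=R^i_i$. The flag curvature $\mathbf{K}(x,\xi)$ of a 2-dimensional Finsler metric is the function with $\mathrm{Ric}=\mathbf{K}F^2$ (equivalently $\mathbf{K}=g_\xi(R_\xi u,u)/(g_\xi(\xi,\xi)g_\xi(u,u)-g_\xi(\xi,u)^2)$ for any $u$ not parallel to $\xi$). *)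

theory Defs
  imports "HOL-Analysis.Analysis"
begin

definition rK :: real where
  "rK = (exp 2 - 1) / (exp 2 + 1)"

definition alphaF :: "real^2 \<Rightarrow> real^2 \<Rightarrow> real" where
  "alphaF x v = sqrt ((rK^2 - (norm x)^2) * (norm v)^2 + (x \<bullet> v)^2) / (rK^2 - (norm x)^2)"

definition betaF :: "real^2 \<Rightarrow> real^2 \<Rightarrow> real" where
  "betaF x v = (1 - rK^2) * (x \<bullet> v) / ((rK^2 - (norm x)^2) * (1 - (norm x)^2))"

definition FF :: "real^2 \<Rightarrow> real^2 \<Rightarrow> real" where
  "FF x v = alphaF x v + betaF x v"

definition pdx :: "2 \<Rightarrow> (real^2 \<Rightarrow> real^2 \<Rightarrow> real) \<Rightarrow> real^2 \<Rightarrow> real^2 \<Rightarrow> real" where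
  "pdx k f x v = deriv (\<lambda>t. f (x + t *\<^sub>R axis k 1) v) 0"

definition pdxi :: "2 \<Rightarrow> (real^2 \<Rightarrow> real^2 \<Rightarrow> real) \<Rightarrow> real^2 \<Rightarrow> real^2 \<Rightarrow> real" where
  "pdxi k f x v = deriv (\<lambda>t. f x (v + t *\<^sub>R axis k 1)) 0"

definition sqF :: "(real^2 \<Rightarrow> real^2 \<Rightarrow> real) \<Rightarrow> real^2 \<Rightarrow> real^2 \<Rightarrow> real" where
  "sqF F x v = (F x v)^2"

definition fund_g :: "(real^2 \<Rightarrow> real^2 \<Rightarrow> real) \<Rightarrow> 2 \<Rightarrow> 2 \<Rightarrow> real^2 \<Rightarrow> real^2 \<Rightarrow> real" where
  "fund_g F i j x v = 1/2 * pdxi i (pdxi j (sqF F)) x v"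

definition ginv :: "(real^2 \<Rightarrow> real^2 \<Rightarrow> real) \<Rightarrow> real^2 \<Rightarrow> real^2 \<Rightarrow> real^2^2" where
  "ginv F x v = matrix_inv (\<chi> i j. fund_g F i j x v)"

definition spray :: "(real^2 \<Rightarrow> real^2 \<Rightarrow> real) \<Rightarrow> 2 \<Rightarrow> real^2 \<Rightarrow> real^2 \<Rightarrow> real" where
  "spray F i x v = 1/4 * (\<Sum>l\<in>UNIV. ginv F x v $ i $ l *
      ((\<Sum>k\<in>UNIV. pdxi l (pdx k (sqF F)) x v * v $ k) - pdx l (sqF F) x v))"

definition riemann :: "(real^2 \<Rightarrow> real^2 \<Rightarrow> real) \<Rightarrow> 2 \<Rightarrow> 2 \<Rightarrow> real^2 \<Rightarrow> real^2 \<Rightarrow> real" where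
  "riemann F i k x v =
     2 * pdx k (spray F i) x v
     - (\<Sum>j\<in>UNIV. v $ j * pdx j (pdxi k (spray F i)) x v)
     + 2 * (\<Sum>j\<in>UNIV. spray F j x v * pdxi j (pdxi k (spray F i)) x v)
     - (\<Sum>j\<in>UNIV. pdxi j (spray F i) x v * pdxi k (spray F j) x v)"

definition ricci :: "(real^2 \<Rightarrow> real^2 \<Rightarrow> real) \<Rightarrow> real^2 \<Rightarrow> real^2 \<Rightarrow> real" where
  "ricci F x v = (\<Sum>i\<in>UNIV. riemann F i i x v)"

text \<open>Flag curvature of a 2-dimensional Finsler metric: Ric = K F^2.\<close>

definition flag_curv :: "(real^2 \<Rightarrow> real^2 \<Rightarrow> real) \<Rightarrow> real^2 \<Rightarrow> real^2 \<Rightarrow> real" where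
  "flag_curv F x v = ricci F x v / (F x v)^2"

end

theory Submission
  imports Defs
begin

text \<open>
  The Klein part \<open>\<alpha>\<close> is projectively flat with projective factor \<open>p = \<langle>x,\<xi>\<rangle> / (r\<^sup>2 - |x|\<^sup>2)\<close>, and
  \<open>\<beta>\<close> is closed. This is captured by the single identity
  \<open>F\<^bsub>x\<^sup>k\<^esub> = (p F)\<^bsub>\<xi>\<^sup>k\<^esub> + \<phi>\<^bsub>\<xi>\<^sup>k\<^esub> / 2\<close>, from which Hamel's condition follows, so the spray is
  \<open>G\<^sup>i = P \<xi>\<^sup>i\<close> with \<open>P = p + \<phi> / (2 F)\<close>. For such a spray, Euler's relations reduce the curvature to
  \<open>R\<^sup>i\<^sub>k = (P\<^sup>2 - P\<^bsub>x\<^sup>j\<^esub> \<xi>\<^sup>j) \<delta>\<^sup>i\<^sub>k + (2 P\<^bsub>x\<^sup>k\<^esub> - \<xi>\<^sup>j P\<^bsub>x\<^sup>j \<xi>\<^sup>k\<^esub> - P P\<^bsub>\<xi>\<^sup>k\<^esub>) \<xi>\<^sup>i\<close>.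
  Once \<open>F\<close> and its derivatives are treated as symbols subject to the identity above, what remains to be
  checked is rational in \<open>x\<close> and \<open>\<xi>\<close>: the square root in \<open>\<alpha>\<close> has disappeared.
\<close>

section \<open>Partial derivatives as derivatives along coordinate lines\<close>

abbreviation has_pdx where
  "has_pdx k f f' x v \<equiv>
    ((\<lambda>t. f (x + t *\<^sub>R axis k (1::real)) v) has_real_derivative f') (at 0)"

abbreviation has_pdxi where
  "has_pdxi k f f' x v \<equiv>
    ((\<lambda>t. f x (v + t *\<^sub>R axis k (1::real))) has_real_derivative f') (at 0)"

text \<open>The zero vector is excluded because \<open>alphaF\<close> is a norm in \<open>v\<close>
  and has no derivative there. What remains is open, which iterated partial derivatives
  need.\<close>

definition slit_tangent :: "real^2 \<Rightarrow> real^2 \<Rightarrow> bool" where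
  "slit_tangent x v \<longleftrightarrow> norm x < rK \<and> v \<noteq> 0"

lemma pdx_eqI: "has_pdx k f f' x v \<Longrightarrow> pdx k f x v = f'"
  unfolding pdx_def by (rule DERIV_imp_deriv)

lemma pdxi_eqI: "has_pdxi k f f' x v \<Longrightarrow> pdxi k f x v = f'"
  unfolding pdxi_def by (rule DERIV_imp_deriv)

lemma eventually_slit_tangent_x:
  assumes "slit_tangent x v"
  shows "\<forall>\<^sub>F t in nhds 0. slit_tangent (x + t *\<^sub>R axis k (1::real)) v"
proof -
  have "((\<lambda>t. norm (x + t *\<^sub>R axis k (1::real))) \<longlongrightarrow> norm (x + 0 *\<^sub>R axis k (1::real))) (nhds 0)"
    by (intro tendsto_intros filterlim_ident)
  then have "\<forall>\<^sub>F t in nhds 0. norm (x + t *\<^sub>R axis k (1::real)) < rK"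
    using assms by (intro order_tendstoD(2)) (auto simp: slit_tangent_def)
  then show ?thesis using assms by (simp add: slit_tangent_def)
qed

lemma eventually_slit_tangent_v:
  assumes "slit_tangent x v"
  shows "\<forall>\<^sub>F t in nhds 0. slit_tangent x (v + t *\<^sub>R axis k (1::real))"
proof -
  have "((\<lambda>t. v + t *\<^sub>R axis k (1::real)) \<longlongrightarrow> v + 0 *\<^sub>R axis k (1::real)) (nhds 0)"
    by (intro tendsto_intros filterlim_ident)
  then have "\<forall>\<^sub>F t in nhds 0. v + t *\<^sub>R axis k (1::real) \<noteq> 0"
    by (rule tendsto_imp_eventually_ne) (use assms in \<open>simp add: slit_tangent_def\<close>)
  then show ?thesis using assms by (simp add: slit_tangent_def)
qed

text \<open>In an iterated partial derivative the inner function is known in closed form only on the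
  domain. Openness makes the two agree near \<open>t = 0\<close>, and \<open>deriv\<close> depends
  on nothing else.\<close>

lemma pdx_eqI_on_slit_tangent:
  assumes "slit_tangent x v" "\<And>y u. slit_tangent y u \<Longrightarrow> f y u = g y u" "has_pdx k g g' x v"
  shows "pdx k f x v = g'"
proof -
  have "\<forall>\<^sub>F t in nhds 0. f (x + t *\<^sub>R axis k 1) v = g (x + t *\<^sub>R axis k 1) v"
    by (rule eventually_mono[OF eventually_slit_tangent_x[OF assms(1)]]) (rule assms(2))
  then have "has_pdx k f g' x v"
    using assms(3) by (simp add: DERIV_cong_ev)
  then show ?thesis by (rule pdx_eqI)
qed

lemma pdxi_eqI_on_slit_tangent:
  assumes "slit_tangent x v" "\<And>y u. slit_tangent y u \<Longrightarrow> f y u = g y u" "has_pdxi k g g' x v"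
  shows "pdxi k f x v = g'"
proof -
  have "\<forall>\<^sub>F t in nhds 0. f x (v + t *\<^sub>R axis k 1) = g x (v + t *\<^sub>R axis k 1)"
    by (rule eventually_mono[OF eventually_slit_tangent_v[OF assms(1)]]) (rule assms(2))
  then have "has_pdxi k f g' x v"
    using assms(3) by (simp add: DERIV_cong_ev)
  then show ?thesis by (rule pdxi_eqI)
qed

section \<open>Coordinate formulas in the plane and their derivatives along lines\<close>

definition kron :: "2 \<Rightarrow> 2 \<Rightarrow> real" where "kron i j = (if i = j then 1 else 0)"

lemma norm_sq_vec_2: "(norm (x::real^2))\<^sup>2 = (x$1)\<^sup>2 + (x$2)\<^sup>2"
  by (simp only: power2_norm_eq_inner) (simp add: inner_vec_def sum_2 power2_eq_square)

lemma inner_vec_2: "(x::real^2) \<bullet> v = x$1 * v$1 + x$2 * v$2"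
  by (simp add: inner_vec_def sum_2)

lemma DERIV_component_line:
  "((\<lambda>t. (x + t *\<^sub>R axis k (1::real)) $ j) has_real_derivative kron j k) (at 0)"
  for x :: "real^2"
  by (auto simp: kron_def axis_def intro!: derivative_eq_intros)

lemma DERIV_inner_line_left:
  "((\<lambda>t. (x + t *\<^sub>R axis k (1::real)) \<bullet> v) has_real_derivative v$k) (at 0)"
  for x :: "real^2"
  by (auto simp: inner_add_left inner_axis' intro!: derivative_eq_intros)

lemma DERIV_inner_line_right:
  "((\<lambda>t. x \<bullet> (v + t *\<^sub>R axis k (1::real))) has_real_derivative x$k) (at 0)"
  for x :: "real^2"
  by (auto simp: inner_add_right inner_axis intro!: derivative_eq_intros)

lemma DERIV_norm_power2_line:
  "((\<lambda>t. (norm (x + t *\<^sub>R axis k (1::real)))\<^sup>2) has_real_derivative 2 * x$k) (at 0)"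
  for x :: "real^2"
  by (auto simp: power2_norm_eq_inner inner_add_left inner_add_right inner_axis inner_axis' inner_axis_axis
      intro!: derivative_eq_intros)

section \<open>Positivity of the denominators, of \<alpha> and of F\<close>

definition norm_sq :: "real^2 \<Rightarrow> real" where "norm_sq v = (norm v)\<^sup>2"

text \<open>Named so that simplification treats this denominator and \<open>gap1\<close> as positive
  atoms; the derivative identities below are then rational in them.\<close>

definition gapK :: "real^2 \<Rightarrow> real" where "gapK x = rK\<^sup>2 - (norm x)\<^sup>2"

definition gap1 :: "real^2 \<Rightarrow> real" where "gap1 x = 1 - (norm x)\<^sup>2"

lemma rK_bounds: "0 < rK" "rK < 1"
  by (auto simp: rK_def field_simps add_pos_pos)

lemma rK_sq_less: "rK\<^sup>2 < 1"
  using rK_bounds by (simp add: power_less_one_iff abs_square_less_1)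

lemma gapK_pos: "slit_tangent x v \<Longrightarrow> gapK x > 0"
  unfolding slit_tangent_def gapK_def by (simp add: power_strict_mono)

lemma gapK_less_gap1: "gapK x < gap1 x"
  using rK_sq_less by (simp add: gapK_def gap1_def)

lemma gap1_pos: "slit_tangent x v \<Longrightarrow> gap1 x > 0"
  using gapK_pos gapK_less_gap1 by (meson order.strict_trans)

lemma alphaF_sq:
  "slit_tangent x v \<Longrightarrow> (alphaF x v)\<^sup>2 = (gapK x * (norm v)\<^sup>2 + (x \<bullet> v)\<^sup>2) / (gapK x)\<^sup>2"
  using gapK_pos[of x v] by (simp add: alphaF_def power_divide gapK_def)

lemma alphaF_pos:
  assumes "slit_tangent x v"
  shows "alphaF x v > 0"
proof -
  have "gapK x * (norm v)\<^sup>2 + (x \<bullet> v)\<^sup>2 > 0"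
    using gapK_pos[OF assms] assms by (auto simp: slit_tangent_def intro!: add_pos_nonneg)
  then show ?thesis using gapK_pos[OF assms] by (simp add: alphaF_def gapK_def)
qed

text \<open>As \<open>1 - rK^2\<close> is at most \<open>gap1 x\<close>, the size of \<beta> is at
  most that of \<open>(x \<bullet> v) / gapK x\<close>. The square of \<alpha> exceeds the square of
  this quotient by \<open>(norm v)^2 / gapK x\<close>, which is positive for nonzero
  \<open>v\<close>.\<close>

lemma FF_pos:
  assumes "slit_tangent x v"
  shows "FF x v > 0"
proof -
  note pos = gapK_pos[OF assms] gap1_pos[OF assms]
  have c: "0 < 1 - rK\<^sup>2" "1 - rK\<^sup>2 \<le> gap1 x"
    using rK_sq_less pos by (auto simp: gapK_def gap1_def)
  have "\<bar>betaF x v\<bar> = (1 - rK\<^sup>2) / gap1 x * (\<bar>x \<bullet> v\<bar> / gapK x)"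
    using pos c by (simp add: betaF_def gapK_def gap1_def abs_mult)
  also have "\<dots> \<le> 1 * (\<bar>x \<bullet> v\<bar> / gapK x)"
    using pos c by (intro mult_right_mono) auto
  also have "\<dots> < alphaF x v"
  proof -
    have "(\<bar>x \<bullet> v\<bar> / gapK x)\<^sup>2 < (alphaF x v)\<^sup>2"
      using pos assms by (simp add: alphaF_sq power_divide divide_strict_right_mono slit_tangent_def)
    then show ?thesis using alphaF_pos[OF assms] by (simp add: power_less_imp_less_base)
  qed
  finally show ?thesis by (simp add: FF_def)
qed

text \<open>Suffixes \<open>_v\<close> and \<open>_x\<close> mark the closed forms of the derivatives in \<open>\<xi>\<close> (here \<open>v\<close>) and \<open>x\<close>;
  \<open>projK\<close> is the projective factor of \<open>\<alpha>\<close>.\<close>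

definition projK :: "real^2 \<Rightarrow> real^2 \<Rightarrow> real" where "projK x v = (x \<bullet> v) / gapK x"

text \<open>The derivative of \<beta> along the geodesics of \<alpha>, that is, the covariant
  derivative of the one-form \<beta> evaluated on \<open>v\<close> twice.\<close>

definition phiF :: "real^2 \<Rightarrow> real^2 \<Rightarrow> real" where
  "phiF x v = (1 - rK\<^sup>2) * (gap1 x * norm_sq v + 2 * (x \<bullet> v)\<^sup>2) / (gapK x * (gap1 x)\<^sup>2)"

definition phiF_v :: "2 \<Rightarrow> real^2 \<Rightarrow> real^2 \<Rightarrow> real" where
  "phiF_v k x v = (1 - rK\<^sup>2) * (2 * gap1 x * v$k + 4 * (x \<bullet> v) * x$k) / (gapK x * (gap1 x)\<^sup>2)"

definition phiF_vv :: "2 \<Rightarrow> 2 \<Rightarrow> real^2 \<Rightarrow> real" where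
  "phiF_vv k j x = (1 - rK\<^sup>2) * (2 * gap1 x * kron k j + 4 * x$k * x$j) / (gapK x * (gap1 x)\<^sup>2)"

definition phiF_x :: "2 \<Rightarrow> real^2 \<Rightarrow> real^2 \<Rightarrow> real" where
  "phiF_x j x v = (1 - rK\<^sup>2) * (4 * (x \<bullet> v) * v$j - 2 * x$j * norm_sq v) / (gapK x * (gap1 x)\<^sup>2)
     + phiF x v * (2 * x$j / gapK x + 4 * x$j / gap1 x)"

definition phiF_vx :: "2 \<Rightarrow> 2 \<Rightarrow> real^2 \<Rightarrow> real^2 \<Rightarrow> real" where
  "phiF_vx k j x v = (1 - rK\<^sup>2) * (4 * v$j * x$k - 4 * x$j * v$k + 4 * (x \<bullet> v) * kron k j) / (gapK x * (gap1 x)\<^sup>2)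
     + phiF_v k x v * (2 * x$j / gapK x + 4 * x$j / gap1 x)"

definition alphaF_v :: "2 \<Rightarrow> real^2 \<Rightarrow> real^2 \<Rightarrow> real" where
  "alphaF_v k x v = (gapK x * v$k + (x \<bullet> v) * x$k) / (alphaF x v * (gapK x)\<^sup>2)"

text \<open>The product rule for \<open>projK * alphaF\<close> in \<open>v^k\<close>: this form
  records the projective flatness of the Klein metric.\<close>

definition alphaF_x :: "2 \<Rightarrow> real^2 \<Rightarrow> real^2 \<Rightarrow> real" where
  "alphaF_x k x v = x$k / gapK x * alphaF x v + projK x v * alphaF_v k x v"

text \<open>Built from \<alpha> alone: \<beta> is linear in \<open>v\<close>, so F and \<alpha> have
  the same Hessian.\<close>

definition FF_vv :: "2 \<Rightarrow> 2 \<Rightarrow> real^2 \<Rightarrow> real^2 \<Rightarrow> real" where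
  "FF_vv k j x v = ((gapK x * kron k j + x$k * x$j) / (gapK x)\<^sup>2 - alphaF_v k x v * alphaF_v j x v) / alphaF x v"

definition betaF_v :: "2 \<Rightarrow> real^2 \<Rightarrow> real" where
  "betaF_v k x = (1 - rK\<^sup>2) * x$k / (gapK x * gap1 x)"

definition FF_v :: "2 \<Rightarrow> real^2 \<Rightarrow> real^2 \<Rightarrow> real" where
  "FF_v k x v = alphaF_v k x v + betaF_v k x"

definition FF_x :: "2 \<Rightarrow> real^2 \<Rightarrow> real^2 \<Rightarrow> real" where
  "FF_x k x v = x$k / gapK x * FF x v + projK x v * FF_v k x v + phiF_v k x v / 2"

definition FF_vx :: "2 \<Rightarrow> 2 \<Rightarrow> real^2 \<Rightarrow> real^2 \<Rightarrow> real" where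
  "FF_vx k j x v = x$k / gapK x * FF_v j x v + x$j / gapK x * FF_v k x v + projK x v * FF_vv k j x v + phiF_vv k j x / 2"

section \<open>Verification of the closed forms of the derivatives\<close>

lemma DERIV_norm_sq_line:
  "((\<lambda>t. norm_sq (x + t *\<^sub>R axis k (1::real))) has_real_derivative 2 * x$k) (at 0)"
  unfolding norm_sq_def by (rule DERIV_norm_power2_line)

lemma axis_eq_kron: "axis k (1::real) $ j = kron j k" by (simp add: axis_def kron_def)

lemma DERIV_gapK_line:
  "((\<lambda>t. gapK (x + t *\<^sub>R axis k (1::real))) has_real_derivative - 2 * x$k) (at 0)"
  unfolding gapK_def by (rule derivative_eq_intros DERIV_norm_power2_line refl | simp)+

lemma DERIV_gap1_line:
  "((\<lambda>t. gap1 (x + t *\<^sub>R axis k (1::real))) has_real_derivative - 2 * x$k) (at 0)"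
  unfolding gap1_def by (rule derivative_eq_intros DERIV_norm_power2_line refl | simp)+

lemmas DERIV_line_intros = DERIV_component_line DERIV_inner_line_left DERIV_inner_line_right
  DERIV_norm_power2_line DERIV_norm_sq_line DERIV_gapK_line DERIV_gap1_line

lemma kron_commute: "kron i j = kron j i" by (simp add: kron_def)

lemma projK_pdx:
  assumes "slit_tangent x v"
  shows "has_pdx k projK (v$k / gapK x + 2 * (x \<bullet> v) * x$k / (gapK x)\<^sup>2) x v"
  unfolding projK_def using gapK_pos[OF assms]
  by (auto intro!: derivative_eq_intros DERIV_line_intros simp: field_simps power2_eq_square)

lemma projK_pdxi:
  assumes "slit_tangent x v"
  shows "has_pdxi k projK (x$k / gapK x) x v"
  unfolding projK_def using gapK_pos[OF assms]
  by (auto intro!: derivative_eq_intros DERIV_line_intros simp: field_simps power2_eq_square)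

lemma phiF_pdx:
  assumes "slit_tangent x v"
  shows "has_pdx k phiF (phiF_x k x v) x v"
  unfolding phiF_def[abs_def] phiF_x_def using gapK_pos[OF assms] gap1_pos[OF assms]
  by (auto intro!: derivative_eq_intros DERIV_line_intros
     simp: divide_simps axis_eq_kron) (simp_all add: algebra_simps power2_eq_square)

lemma phiF_pdxi:
  assumes "slit_tangent x v"
  shows "has_pdxi k phiF (phiF_v k x v) x v"
  unfolding phiF_def[abs_def] phiF_v_def using gapK_pos[OF assms] gap1_pos[OF assms]
  by (auto intro!: derivative_eq_intros DERIV_line_intros
     simp: divide_simps axis_eq_kron)

lemma phiF_v_pdx:
  assumes "slit_tangent x v"
  shows "has_pdx j (phiF_v k) (phiF_vx k j x v) x v"
  unfolding phiF_v_def[abs_def] phiF_vx_def using gapK_pos[OF assms] gap1_pos[OF assms]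
  by (auto intro!: derivative_eq_intros DERIV_line_intros
     simp: divide_simps axis_eq_kron) (simp_all add: algebra_simps power2_eq_square)

lemma phiF_v_pdxi:
  assumes "slit_tangent x v"
  shows "has_pdxi j (phiF_v k) (phiF_vv k j x) x v"
  unfolding phiF_v_def[abs_def] phiF_vv_def using gapK_pos[OF assms] gap1_pos[OF assms]
  by (auto intro!: derivative_eq_intros DERIV_line_intros
     simp: divide_simps axis_eq_kron)

lemma alphaF_sq_mult:
  "slit_tangent x v \<Longrightarrow> (alphaF x v)\<^sup>2 * (gapK x)\<^sup>2 = gapK x * norm_sq v + (x \<bullet> v)\<^sup>2"
  using gapK_pos[of x v] by (simp add: alphaF_sq norm_sq_def)

lemma alphaF_alt: "alphaF x v = sqrt (gapK x * norm_sq v + (x \<bullet> v)\<^sup>2) / gapK x"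
  by (simp add: alphaF_def gapK_def norm_sq_def)

lemma alphaF_pdxi:
  assumes "slit_tangent x v"
  shows "has_pdxi k alphaF (alphaF_v k x v) x v"
proof -
  have pos: "gapK x * norm_sq v + (x \<bullet> v)\<^sup>2 > 0" "gapK x > 0"
    using gapK_pos[OF assms] assms by (auto simp: slit_tangent_def norm_sq_def intro!: add_pos_nonneg)
  have "has_pdxi k (\<lambda>x v. sqrt (gapK x * norm_sq v + (x \<bullet> v)\<^sup>2) / gapK x) (alphaF_v k x v) x v"
    using pos by (auto intro!: derivative_eq_intros DERIV_line_intros
      simp: alphaF_v_def alphaF_alt power2_eq_square field_simps)
  then show ?thesis by (simp add: alphaF_alt[abs_def])
qed

lemma alphaF_pdx:
  assumes "slit_tangent x v"
  shows "has_pdx k alphaF (alphaF_x k x v) x v"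
proof -
  define A where "A = sqrt (gapK x * norm_sq v + (x \<bullet> v)\<^sup>2)"
  have pos: "gapK x * norm_sq v + (x \<bullet> v)\<^sup>2 > 0" "gapK x > 0"
    using gapK_pos[OF assms] assms by (auto simp: slit_tangent_def norm_sq_def intro!: add_pos_nonneg)
  then have A: "A > 0" "A\<^sup>2 = gapK x * norm_sq v + (x \<bullet> v)\<^sup>2" by (auto simp: A_def)
  have "has_pdx k (\<lambda>x v. sqrt (gapK x * norm_sq v + (x \<bullet> v)\<^sup>2) / gapK x)
     ((((- 2 * x$k * norm_sq v + 2 * (x \<bullet> v) * v$k) / (2 * A)) * gapK x + A * (2 * x$k)) / (gapK x * gapK x)) x v"
    using pos by (auto intro!: derivative_eq_intros DERIV_line_intros
      simp: A_def field_simps)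
  \<comment> \<open>The two sides differ by a multiple of
    \<open>A^2 - (gapK x * norm_sq v + (x \<bullet> v)^2)\<close>, so the equation for
    \<open>A^2\<close> is all that is needed about the square root.\<close>
  moreover have "((((- 2 * x$k * norm_sq v + 2 * (x \<bullet> v) * v$k) / (2 * A)) * gapK x + A * (2 * x$k)) / (gapK x * gapK x))
     = alphaF_x k x v"
    unfolding alphaF_x_def alphaF_v_def alphaF_alt projK_def A_def[symmetric]
    using pos(2) A by (simp add: divide_simps) algebra
  ultimately show ?thesis by (simp add: alphaF_alt[abs_def])
qed

lemma alphaF_v_pdxi:
  assumes "slit_tangent x v"
  shows "has_pdxi j (alphaF_v k) (FF_vv k j x v) x v"
  unfolding alphaF_v_def[of k, abs_def] using gapK_pos[OF assms] alphaF_pos[OF assms]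
  by (auto intro!: derivative_eq_intros DERIV_line_intros alphaF_pdxi assms
      simp: FF_vv_def alphaF_v_def axis_eq_kron divide_simps)

lemma alphaF_v_pdx:
  assumes "slit_tangent x v"
  shows "has_pdx j (alphaF_v k)
    (x$k / gapK x * alphaF_v j x v + x$j / gapK x * alphaF_v k x v + projK x v * FF_vv k j x v) x v"
  unfolding alphaF_v_def[of k, abs_def]
  by (rule derivative_eq_intros DERIV_line_intros alphaF_pdx assms refl)+
    (use gapK_pos[OF assms] alphaF_pos[OF assms] in
      \<open>simp_all add: FF_vv_def alphaF_x_def projK_def alphaF_v_def axis_eq_kron divide_simps,
        simp add: algebra_simps power2_eq_square\<close>)

lemma betaF_alt: "betaF x v = (1 - rK\<^sup>2) * (x \<bullet> v) / (gapK x * gap1 x)"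
  by (simp add: betaF_def gapK_def gap1_def)

text \<open>Since \<beta> is closed, its derivative in \<open>x^k\<close> is half the
  \<open>v\<close>-gradient of a quadratic form. That form is
  \<open>2 * projK * betaF + phiF\<close>, so \<beta> misses the identity satisfied by \<alpha> by
  half the gradient of \<open>phiF\<close>.\<close>

definition betaF_x :: "2 \<Rightarrow> real^2 \<Rightarrow> real^2 \<Rightarrow> real" where
  "betaF_x k x v = x$k / gapK x * betaF x v + projK x v * betaF_v k x + phiF_v k x v / 2"

lemma betaF_pdx:
  assumes "slit_tangent x v"
  shows "has_pdx k betaF (betaF_x k x v) x v"
  unfolding betaF_alt[abs_def] betaF_x_def betaF_v_def projK_def phiF_v_def using gapK_pos[OF assms] gap1_pos[OF assms]
  by (auto intro!: derivative_eq_intros DERIV_line_intros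
     simp: divide_simps axis_eq_kron) (simp_all add: algebra_simps power2_eq_square)

lemma betaF_pdxi:
  assumes "slit_tangent x v"
  shows "has_pdxi k betaF (betaF_v k x) x v"
  unfolding betaF_alt[abs_def] betaF_v_def using gapK_pos[OF assms] gap1_pos[OF assms]
  by (auto intro!: derivative_eq_intros DERIV_line_intros
     simp: divide_simps axis_eq_kron)

lemma betaF_v_pdx:
  assumes "slit_tangent x v"
  shows "((\<lambda>t. betaF_v k (x + t *\<^sub>R axis j 1)) has_real_derivative
    x$k / gapK x * betaF_v j x + x$j / gapK x * betaF_v k x + phiF_vv k j x / 2) (at 0)"
  unfolding betaF_v_def phiF_vv_def using gapK_pos[OF assms] gap1_pos[OF assms]
  by (auto intro!: derivative_eq_intros DERIV_line_intros
     simp: divide_simps axis_eq_kron) (simp_all add: algebra_simps power2_eq_square)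

text \<open>The central identity for F, obtained by adding those for \<alpha> and \<beta>.\<close>

lemma FF_pdx: "slit_tangent x v \<Longrightarrow> has_pdx k FF (FF_x k x v) x v"
  unfolding FF_def[abs_def]
  by (rule derivative_eq_intros alphaF_pdx betaF_pdx | assumption)+
    (simp add: alphaF_x_def betaF_x_def FF_x_def FF_def FF_v_def algebra_simps)

lemma FF_pdxi: "slit_tangent x v \<Longrightarrow> has_pdxi k FF (FF_v k x v) x v"
  unfolding FF_def[abs_def] FF_v_def
  by (rule derivative_intros alphaF_pdxi betaF_pdxi | assumption)+

lemma FF_v_pdx: "slit_tangent x v \<Longrightarrow> has_pdx j (FF_v k) (FF_vx k j x v) x v"
  unfolding FF_v_def[of k, abs_def]
  by (rule derivative_eq_intros alphaF_v_pdx betaF_v_pdx | assumption)+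
    (simp add: FF_vx_def FF_v_def algebra_simps)

lemma FF_v_pdxi: "slit_tangent x v \<Longrightarrow> has_pdxi j (FF_v k) (FF_vv k j x v) x v"
  unfolding FF_v_def[of k, abs_def]
  by (rule derivative_eq_intros alphaF_v_pdxi | assumption | simp)+

text \<open>Both orders of mixed differentiation occur, this one in the spray and that of
  \<open>FF_v_pdx\<close> in the curvature; they share one closed form.\<close>

lemma FF_x_pdxi: "slit_tangent x v \<Longrightarrow> has_pdxi j (FF_x k) (FF_vx k j x v) x v"
  unfolding FF_x_def[of k, abs_def]
  by (rule derivative_eq_intros FF_pdxi FF_v_pdxi projK_pdxi phiF_v_pdxi refl | assumption | simp)+
    (simp add: FF_vx_def algebra_simps)

section \<open>Euler relations for F and the fundamental tensor\<close>

lemma alphaF_v_euler: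
  assumes "slit_tangent x v"
  shows "v$1 * alphaF_v 1 x v + v$2 * alphaF_v 2 x v = alphaF x v"
proof -
  have "v$1 * alphaF_v 1 x v + v$2 * alphaF_v 2 x v
      = (gapK x * ((v$1)\<^sup>2 + (v$2)\<^sup>2) + (x \<bullet> v)\<^sup>2) / (alphaF x v * (gapK x)\<^sup>2)"
    by (simp add: alphaF_v_def inner_vec_2 add_divide_distrib algebra_simps power2_eq_square)
  also have "\<dots> = (alphaF x v)\<^sup>2 * (gapK x)\<^sup>2 / (alphaF x v * (gapK x)\<^sup>2)"
    unfolding alphaF_sq_mult[OF assms] norm_sq_def norm_sq_vec_2 ..
  also have "\<dots> = alphaF x v"
    using alphaF_pos[OF assms] gapK_pos[OF assms] by (simp add: power2_eq_square)
  finally show ?thesis .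
qed

lemma FF_v_euler:
  assumes "slit_tangent x v"
  shows "v$1 * FF_v 1 x v + v$2 * FF_v 2 x v = FF x v"
proof -
  have "v$1 * betaF_v 1 x + v$2 * betaF_v 2 x = betaF x v"
    by (simp add: betaF_v_def betaF_alt inner_vec_2 add_divide_distrib[symmetric] algebra_simps)
  then show ?thesis using alphaF_v_euler[OF assms] by (simp add: FF_v_def FF_def algebra_simps)
qed

text \<open>The Hessian of \<open>F\<close> in \<open>\<xi>\<close> annihilates \<open>\<xi>\<close>, so in dimension two it is a multiple of
  the square of the covector \<open>rot\<close>.\<close>

definition rot :: "2 \<Rightarrow> real^2 \<Rightarrow> real" where "rot k v = (if k = 1 then v$2 else - v$1)"

text \<open>The explicit positive factor later gives invertibility of the fundamental tensor. After
  clearing denominators \<alpha> occurs only squared; replacing its square leaves a polynomial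
  identity, checked for each pair of indices.\<close>

lemma FF_vv_rank_one:
  assumes "slit_tangent x v"
  shows "FF_vv k j x v = rK\<^sup>2 / (alphaF x v * gapK x)^3 * rot k v * rot j v"
proof -
  define S where "S = gapK x * norm_sq v + (x \<bullet> v)\<^sup>2"
  have S: "(alphaF x v)\<^sup>2 * (gapK x)\<^sup>2 = S" using alphaF_sq_mult[OF assms] by (simp add: S_def)
  have r: "rK\<^sup>2 = gapK x + (x$1)\<^sup>2 + (x$2)\<^sup>2" by (simp add: gapK_def norm_sq_vec_2)
  have 12: "k = 1 \<or> k = 2" "j = 1 \<or> j = 2" using exhaust_2 by auto
  then have "(gapK x * kron k j + x$k * x$j) * S
      - (gapK x * v$k + (x \<bullet> v) * x$k) * (gapK x * v$j + (x \<bullet> v) * x$j) = gapK x * rK\<^sup>2 * rot k v * rot j v"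
    unfolding S_def r norm_sq_def norm_sq_vec_2 inner_vec_2
    by (elim disjE) (simp_all add: kron_def rot_def algebra_simps power2_eq_square)
  then have "rK\<^sup>2 * rot k v * rot j v = ((gapK x * kron k j + x$k * x$j) * ((alphaF x v)\<^sup>2 * (gapK x)\<^sup>2)
      - (gapK x * v$k + (x \<bullet> v) * x$k) * (gapK x * v$j + (x \<bullet> v) * x$j)) / gapK x"
    unfolding S using gapK_pos[OF assms] by (simp add: field_simps)
  then have "rK\<^sup>2 / (alphaF x v * gapK x)^3 * rot k v * rot j v =
    ((gapK x * kron k j + x$k * x$j) * ((alphaF x v)\<^sup>2 * (gapK x)\<^sup>2)
      - (gapK x * v$k + (x \<bullet> v) * x$k) * (gapK x * v$j + (x \<bullet> v) * x$j)) / gapK x / (alphaF x v * gapK x)^3"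
    by (simp add: field_simps)
  also have "\<dots> = FF_vv k j x v"
    unfolding FF_vv_def alphaF_v_def using alphaF_pos[OF assms] gapK_pos[OF assms]
    by (simp add: divide_simps) (simp add: algebra_simps eval_nat_numeral)
  finally show ?thesis ..
qed

lemma FF_vv_euler:
  assumes "slit_tangent x v"
  shows "v$1 * FF_vv k 1 x v + v$2 * FF_vv k 2 x v = 0"
  by (simp add: FF_vv_rank_one[OF assms] rot_def)

lemma FF_vv_commute: "FF_vv k j x v = FF_vv j k x v"
  by (simp add: FF_vv_def kron_commute mult.commute)

lemma fund_g_FF:
  assumes "slit_tangent x v"
  shows "fund_g FF i j x v = FF_v i x v * FF_v j x v + FF x v * FF_vv i j x v"
proof -
  have 1: "pdxi j (sqF FF) y u = 2 * FF y u * FF_v j y u" if "slit_tangent y u" for y u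
    unfolding sqF_def[abs_def]
    by (rule pdxi_eqI) (rule derivative_eq_intros FF_pdxi that refl | simp)+
  have "pdxi i (pdxi j (sqF FF)) x v = 2 * (FF_v i x v * FF_v j x v + FF x v * FF_vv j i x v)"
    by (rule pdxi_eqI_on_slit_tangent[OF assms 1], assumption)
       (rule derivative_eq_intros FF_pdxi FF_v_pdxi assms refl | simp)+
  then show ?thesis by (simp add: fund_g_def FF_vv_commute)
qed

section \<open>Hamel's condition and the spray\<close>

lemma phiF_v_euler: "v$1 * phiF_v 1 x v + v$2 * phiF_v 2 x v = 2 * phiF x v"
  by (simp only: phiF_v_def phiF_def inner_vec_2 norm_sq_def norm_sq_vec_2)
    (simp add: add_divide_distrib[symmetric] algebra_simps power2_eq_square)

lemma phiF_vv_euler: "v$1 * phiF_vv k 1 x + v$2 * phiF_vv k 2 x = phiF_v k x v"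
proof -
  have "k = 1 \<or> k = 2" using exhaust_2 by auto
  then show ?thesis
    by (elim disjE)
      (simp_all add: phiF_v_def phiF_vv_def kron_def inner_vec_2 add_divide_distrib[symmetric]
        algebra_simps)
qed

lemma projK_euler: "v$1 * (x$1 / gapK x) + v$2 * (x$2 / gapK x) = projK x v"
  by (simp add: projK_def inner_vec_2 add_divide_distrib algebra_simps)

text \<open>The factor dictated by Hamel's condition, namely the contraction of \<open>FF_x\<close>
  with \<open>v\<close> divided by \<open>2 * FF x v\<close>; \<open>FF_x_contract\<close> confirms
  this.\<close>

definition projF :: "real^2 \<Rightarrow> real^2 \<Rightarrow> real" where "projF x v = projK x v + phiF x v / (2 * FF x v)"

text \<open>Hamel's condition. It holds because \<open>FF_x\<close> is itself the
  \<open>v\<close>-gradient of \<open>projK * FF + phiF / 2\<close>.\<close>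

lemma FF_vx_commute: "FF_vx k j x v = FF_vx j k x v"
  by (simp add: FF_vx_def FF_vv_commute[of k j] phiF_vv_def kron_commute[of k j] algebra_simps)

lemma FF_vx_euler_right:
  assumes "slit_tangent x v"
  shows "v$1 * FF_vx k 1 x v + v$2 * FF_vx k 2 x v = FF_x k x v"
proof -
  have "v$1 * FF_vx k 1 x v + v$2 * FF_vx k 2 x v =
     x$k / gapK x * (v$1 * FF_v 1 x v + v$2 * FF_v 2 x v) + (v$1 * (x$1 / gapK x) + v$2 * (x$2 / gapK x)) * FF_v k x v
     + projK x v * (v$1 * FF_vv k 1 x v + v$2 * FF_vv k 2 x v) + (v$1 * phiF_vv k 1 x + v$2 * phiF_vv k 2 x) / 2"
    by (simp add: FF_vx_def algebra_simps add_divide_distrib)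
  then show ?thesis
    unfolding FF_v_euler[OF assms] FF_vv_euler[OF assms] phiF_vv_euler projK_euler by (simp add: FF_x_def)
qed

lemma FF_vx_euler_left:
  assumes "slit_tangent x v"
  shows "v$1 * FF_vx 1 k x v + v$2 * FF_vx 2 k x v = FF_x k x v"
  using FF_vx_euler_right[OF assms, of k] by (simp only: FF_vx_commute[of k])

lemma FF_x_contract:
  assumes "slit_tangent x v"
  shows "v$1 * FF_x 1 x v + v$2 * FF_x 2 x v = 2 * projF x v * FF x v"
proof -
  have "v$1 * FF_x 1 x v + v$2 * FF_x 2 x v =
     (v$1 * (x$1 / gapK x) + v$2 * (x$2 / gapK x)) * FF x v + projK x v * (v$1 * FF_v 1 x v + v$2 * FF_v 2 x v)
     + (v$1 * phiF_v 1 x v + v$2 * phiF_v 2 x v) / 2"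
    by (simp add: FF_x_def algebra_simps add_divide_distrib)
  then show ?thesis
    unfolding FF_v_euler[OF assms] phiF_v_euler projK_euler
    using FF_pos[OF assms] by (simp add: projF_def field_simps)
qed

text \<open>Hamel's condition and Euler's relations cancel two of the three terms of the bracket
  defining the spray. What is left is \<open>4 * projF x v\<close> times \<open>g *v v\<close>, so
  the inverse of \<open>g\<close> acts trivially and is never computed.\<close>

lemma spray_FF:
  assumes "slit_tangent x v"
  shows "spray FF i x v = projF x v * v$i"
proof -
  define g :: "real^2^2" where "g = (\<chi> i j. fund_g FF i j x v)"
  define mu where "mu = rK\<^sup>2 / (alphaF x v * gapK x)^3"
  note F = FF_pos[OF assms] and E = FF_v_euler[OF assms]
  have g: "g $ i $ j = FF_v i x v * FF_v j x v + FF x v * (mu * rot i v * rot j v)" for i j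
    by (simp add: g_def fund_g_FF[OF assms] FF_vv_rank_one[OF assms] mu_def)
  \<comment> \<open>For a sum of two rank-one matrices in the plane, the determinant is the product
    of the coefficients times the squared determinant of the two covectors. Here these are
    \<open>FF_v\<close> and \<open>rot\<close>, whose determinant is minus the Euler
    contraction.\<close>
  have "det g = FF x v * mu * (v$1 * FF_v 1 x v + v$2 * FF_v 2 x v)^2"
    unfolding det_2 g rot_def by simp algebra
  moreover have "mu > 0" using rK_bounds gapK_pos[OF assms] alphaF_pos[OF assms] by (simp add: mu_def)
  ultimately have "invertible g" using F E by (simp add: invertible_det_nz)
  then have inv: "matrix_inv g ** g = mat 1"
    unfolding matrix_inv_def invertible_def by (rule someI2_ex) simp
  have gv: "(g *v v) $ l = FF x v * FF_v l x v" for l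
  proof -
    have "(g *v v) $ l = FF_v l x v * (v$1 * FF_v 1 x v + v$2 * FF_v 2 x v)
        + FF x v * mu * rot l v * (v$1 * rot 1 v + v$2 * rot 2 v)"
      by (simp add: matrix_vector_mult_def sum_2 g algebra_simps)
    then show ?thesis unfolding E by (simp add: rot_def)
  qed
  have 1: "pdx k (sqF FF) y u = 2 * FF y u * FF_x k y u" if "slit_tangent y u" for y u k
    unfolding sqF_def[abs_def]
    by (rule pdx_eqI) (rule derivative_eq_intros FF_pdx that refl | simp)+
  have 2: "pdxi l (pdx k (sqF FF)) x v = 2 * (FF_v l x v * FF_x k x v + FF x v * FF_vx k l x v)" for k l
    by (rule pdxi_eqI_on_slit_tangent[OF assms 1], assumption)
       (rule derivative_eq_intros FF_pdxi FF_x_pdxi assms refl | simp)+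
  define S :: "real^2" where
    "S = (\<chi> l. (\<Sum>k\<in>UNIV. pdxi l (pdx k (sqF FF)) x v * v $ k) - pdx l (sqF FF) x v)"
  have "S $ l = 4 * projF x v * (g *v v) $ l" for l
  proof -
    have "S $ l = 2 * FF_v l x v * (v$1 * FF_x 1 x v + v$2 * FF_x 2 x v)
        + 2 * FF x v * (v$1 * FF_vx 1 l x v + v$2 * FF_vx 2 l x v) - 2 * FF x v * FF_x l x v"
      by (simp add: S_def sum_2 1[OF assms] 2 algebra_simps)
    also have "\<dots> = 4 * projF x v * (FF x v * FF_v l x v)"
      using F unfolding FF_vx_euler_left[OF assms] FF_x_contract[OF assms] by (simp add: algebra_simps)
    finally show ?thesis by (simp only: gv)
  qed
  then have S: "S = (4 * projF x v) *\<^sub>R (g *v v)" by (simp add: vec_eq_iff)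
  have "spray FF i x v = 1/4 * (matrix_inv g *v S) $ i"
    unfolding spray_def ginv_def g_def[symmetric] by (simp add: matrix_vector_mult_def S_def)
  also have "matrix_inv g *v S = (4 * projF x v) *\<^sub>R v"
    unfolding S by (simp add: matrix_vector_mult_scaleR matrix_vector_mul_assoc inv)
  finally show ?thesis by simp
qed

section \<open>Derivatives of the projective factor and their Euler relations\<close>

definition projF_v :: "2 \<Rightarrow> real^2 \<Rightarrow> real^2 \<Rightarrow> real" where
  "projF_v k x v = x$k / gapK x + phiF_v k x v / (2 * FF x v) - phiF x v * FF_v k x v / (2 * (FF x v)\<^sup>2)"

definition projF_x :: "2 \<Rightarrow> real^2 \<Rightarrow> real^2 \<Rightarrow> real" where
  "projF_x k x v = v$k / gapK x + 2 * (x \<bullet> v) * x$k / (gapK x)\<^sup>2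
     + phiF_x k x v / (2 * FF x v) - phiF x v * FF_x k x v / (2 * (FF x v)\<^sup>2)"

definition projF_vv :: "2 \<Rightarrow> 2 \<Rightarrow> real^2 \<Rightarrow> real^2 \<Rightarrow> real" where
  "projF_vv k j x v = phiF_vv k j x / (2 * FF x v)
     - (phiF_v k x v * FF_v j x v + phiF_v j x v * FF_v k x v + phiF x v * FF_vv k j x v) / (2 * (FF x v)\<^sup>2)
     + phiF x v * FF_v k x v * FF_v j x v / (FF x v)^3"

definition projF_vx :: "2 \<Rightarrow> 2 \<Rightarrow> real^2 \<Rightarrow> real^2 \<Rightarrow> real" where
  "projF_vx k j x v = kron k j / gapK x + 2 * x$k * x$j / (gapK x)\<^sup>2 + phiF_vx k j x v / (2 * FF x v)
     - (phiF_v k x v * FF_x j x v + phiF_x j x v * FF_v k x v + phiF x v * FF_vx k j x v) / (2 * (FF x v)\<^sup>2)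
     + phiF x v * FF_v k x v * FF_x j x v / (FF x v)^3"

text \<open>This rule and the next have the shape of the summands of \<open>projF\<close> and
  \<open>projF_v\<close>, so their derivatives arise by composing rules instead of by simplifying
  large fractions.\<close>

lemma DERIV_div_twice:
  fixes f g :: "real \<Rightarrow> real"
  assumes "(f has_real_derivative f') (at a)" "(g has_real_derivative g') (at a)" "g a \<noteq> 0"
  shows "((\<lambda>t. f t / (2 * g t)) has_real_derivative f' / (2 * g a) - f a * g' / (2 * (g a)\<^sup>2)) (at a)"
  using assms(3) by (auto intro!: derivative_eq_intros assms(1,2) simp: field_simps power2_eq_square)

lemma DERIV_div_twice_sq:
  fixes f g h :: "real \<Rightarrow> real"
  assumes "(f has_real_derivative f') (at a)" "(h has_real_derivative h') (at a)"
    "(g has_real_derivative g') (at a)" "g a \<noteq> 0"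
  shows "((\<lambda>t. f t * h t / (2 * (g t)\<^sup>2)) has_real_derivative
    (f' * h a + f a * h') / (2 * (g a)\<^sup>2) - f a * h a * g' / (g a)^3) (at a)"
  using assms(4) by (auto intro!: derivative_eq_intros assms(1-3) simp: divide_simps)
    (simp add: algebra_simps eval_nat_numeral)

lemma projF_pdxi:
  assumes "slit_tangent x v"
  shows "has_pdxi k projF (projF_v k x v) x v"
  unfolding projF_def[abs_def] using FF_pos[OF assms]
  by (intro DERIV_cong[OF DERIV_add[OF projK_pdxi DERIV_div_twice[OF phiF_pdxi FF_pdxi]]] assms)
    (simp_all add: projF_v_def)

lemma projF_pdx:
  assumes "slit_tangent x v"
  shows "has_pdx k projF (projF_x k x v) x v"
  unfolding projF_def[abs_def] using FF_pos[OF assms]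
  by (intro DERIV_cong[OF DERIV_add[OF projK_pdx DERIV_div_twice[OF phiF_pdx FF_pdx]]] assms)
    (simp_all add: projF_x_def)

lemma projF_v_pdxi:
  assumes "slit_tangent x v"
  shows "has_pdxi j (projF_v k) (projF_vv k j x v) x v"
  unfolding projF_v_def[of k, abs_def] using FF_pos[OF assms]
  by (intro DERIV_cong[OF DERIV_diff[OF DERIV_add[OF DERIV_const DERIV_div_twice[OF phiF_v_pdxi FF_pdxi]]
     DERIV_div_twice_sq[OF phiF_pdxi FF_v_pdxi FF_pdxi]]] assms)
    (simp_all add: projF_vv_def add_divide_distrib)

lemma projF_v_pdx:
  assumes "slit_tangent x v"
  shows "has_pdx j (projF_v k) (projF_vx k j x v) x v"
proof -
  have "((\<lambda>t. (x + t *\<^sub>R axis j 1) $ k / gapK (x + t *\<^sub>R axis j 1)) has_real_derivative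
     kron k j / gapK x + 2 * x$k * x$j / (gapK x)\<^sup>2) (at 0)"
    using gapK_pos[OF assms] by (auto intro!: derivative_eq_intros DERIV_line_intros
     simp: field_simps power2_eq_square axis_eq_kron)
  then show ?thesis
    unfolding projF_v_def[of k, abs_def] using FF_pos[OF assms]
    by (intro DERIV_cong[OF DERIV_diff[OF DERIV_add[OF _ DERIV_div_twice[OF phiF_v_pdx FF_pdx]]
       DERIV_div_twice_sq[OF phiF_pdx FF_v_pdx FF_pdx]]] assms)
      (assumption, simp_all add: projF_vx_def add_divide_distrib)
qed

lemma projF_v_euler:
  assumes "slit_tangent x v"
  shows "v$1 * projF_v 1 x v + v$2 * projF_v 2 x v = projF x v"
proof -
  have "v$1 * projF_v 1 x v + v$2 * projF_v 2 x v = (v$1 * (x$1 / gapK x) + v$2 * (x$2 / gapK x))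
      + (v$1 * phiF_v 1 x v + v$2 * phiF_v 2 x v) / (2 * FF x v)
      - phiF x v * (v$1 * FF_v 1 x v + v$2 * FF_v 2 x v) / (2 * (FF x v)\<^sup>2)"
    by (simp add: projF_v_def algebra_simps add_divide_distrib)
  then show ?thesis unfolding projK_euler phiF_v_euler FF_v_euler[OF assms]
    using FF_pos[OF assms] by (simp add: projF_def power2_eq_square)
qed

lemma projF_vv_euler:
  assumes "slit_tangent x v"
  shows "v$1 * projF_vv k 1 x v + v$2 * projF_vv k 2 x v = 0"
proof -
  have "v$1 * projF_vv k 1 x v + v$2 * projF_vv k 2 x v = (v$1 * phiF_vv k 1 x + v$2 * phiF_vv k 2 x) / (2 * FF x v)
      - (phiF_v k x v * (v$1 * FF_v 1 x v + v$2 * FF_v 2 x v) + (v$1 * phiF_v 1 x v + v$2 * phiF_v 2 x v) * FF_v k x v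
        + phiF x v * (v$1 * FF_vv k 1 x v + v$2 * FF_vv k 2 x v)) / (2 * (FF x v)\<^sup>2)
      + phiF x v * FF_v k x v * (v$1 * FF_v 1 x v + v$2 * FF_v 2 x v) / (FF x v)^3"
    by (simp add: projF_vv_def algebra_simps add_divide_distrib)
  then show ?thesis unfolding phiF_vv_euler phiF_v_euler FF_v_euler[OF assms] FF_vv_euler[OF assms]
    using FF_pos[OF assms] by (simp add: eval_nat_numeral field_simps)
qed

section \<open>Curvature of a spray proportional to \<open>v\<close>\<close>

lemma riemann_projectively_flat:
  assumes "slit_tangent x v"
  shows "riemann FF i k x v = kron i k * ((projF x v)\<^sup>2 - (v$1 * projF_x 1 x v + v$2 * projF_x 2 x v))
     + v$i * (2 * projF_x k x v - (v$1 * projF_vx k 1 x v + v$2 * projF_vx k 2 x v) - projF x v * projF_v k x v)"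
proof -
  have 1: "pdx k (spray FF i) x v = projF_x k x v * v$i" for k i
    by (rule pdx_eqI_on_slit_tangent[OF assms spray_FF], assumption)
      (rule derivative_eq_intros projF_pdx assms refl | simp)+
  \<comment> \<open>Stated on the whole domain, since facts 3 and 4 differentiate it once
    more.\<close>
  have 2: "pdxi k (spray FF i) y u = projF_v k y u * u$i + projF y u * kron i k" if "slit_tangent y u" for k i y u
    by (rule pdxi_eqI_on_slit_tangent[OF that spray_FF], assumption)
      (rule derivative_eq_intros projF_pdxi DERIV_line_intros that refl | simp)+
  have 3: "pdx j (pdxi k (spray FF i)) x v = projF_vx k j x v * v$i + projF_x j x v * kron i k" for i j k
    by (rule pdx_eqI_on_slit_tangent[OF assms 2], assumption)
      (rule derivative_eq_intros projF_pdx projF_v_pdx DERIV_line_intros assms refl | simp)+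
  have 4: "pdxi j (pdxi k (spray FF i)) x v = projF_vv k j x v * v$i + projF_v k x v * kron i j + projF_v j x v * kron i k" for i j k
    by (rule pdxi_eqI_on_slit_tangent[OF assms 2], assumption)
      (rule derivative_eq_intros projF_pdxi projF_v_pdxi DERIV_line_intros assms refl | simp)+
  have kron: "v$1 * kron i 1 + v$2 * kron i 2 = v$i" "projF_v 1 x v * kron 1 k + projF_v 2 x v * kron 2 k = projF_v k x v"
    "kron i 1 * kron 1 k + kron i 2 * kron 2 k = kron i k"
    using exhaust_2[of i] exhaust_2[of k] by (auto simp: kron_def)
  \<comment> \<open>Grouped so that each bracket is an Euler contraction or a sum against
    \<open>kron\<close>, ready to be rewritten.\<close>
  have "riemann FF i k x v = 2 * projF_x k x v * v$i
      - v$i * (v$1 * projF_vx k 1 x v + v$2 * projF_vx k 2 x v) - kron i k * (v$1 * projF_x 1 x v + v$2 * projF_x 2 x v)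
      + 2 * projF x v * (v$i * (v$1 * projF_vv k 1 x v + v$2 * projF_vv k 2 x v)
          + projF_v k x v * (v$1 * kron i 1 + v$2 * kron i 2) + kron i k * (v$1 * projF_v 1 x v + v$2 * projF_v 2 x v))
      - (v$i * projF_v k x v * (v$1 * projF_v 1 x v + v$2 * projF_v 2 x v)
          + v$i * projF x v * (projF_v 1 x v * kron 1 k + projF_v 2 x v * kron 2 k)
          + projF x v * projF_v k x v * (v$1 * kron i 1 + v$2 * kron i 2)
          + (projF x v)\<^sup>2 * (kron i 1 * kron 1 k + kron i 2 * kron 2 k))"
    unfolding riemann_def sum_2 1 3 4 2[OF assms] spray_FF[OF assms]
    by (simp add: algebra_simps power2_eq_square)
  then show ?thesis
    unfolding kron projF_v_euler[OF assms] projF_vv_euler[OF assms]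
    by (simp add: algebra_simps power2_eq_square)
qed

section \<open>The two contractions in the curvature formula\<close>

definition psiF :: "real^2 \<Rightarrow> real^2 \<Rightarrow> real" where
  "psiF x v = 2 * (1 - rK\<^sup>2) * (x \<bullet> v) / ((gap1 x)^3 * (gapK x)\<^sup>2)
              * (gap1 x * norm_sq v * (3 * gapK x - gap1 x) + 2 * (x \<bullet> v)\<^sup>2 * (2 * gapK x - gap1 x))"

lemma norm_sq_alt: "norm_sq v = v$1 * v$1 + v$2 * v$2"
  unfolding norm_sq_def norm_sq_vec_2 by (simp add: power2_eq_square)

text \<open>Identifies \<open>psiF\<close> as the derivative of \<open>phiF\<close> along the
  geodesics of \<alpha>. The correction has factor 4 because that spray is \<open>projK x v\<close>
  times \<open>v\<close> and \<open>phiF\<close> has degree two in \<open>v\<close>.\<close>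

lemma phiF_x_contract:
  assumes "slit_tangent x v"
  shows "v$1 * phiF_x 1 x v + v$2 * phiF_x 2 x v = psiF x v + 4 * projK x v * phiF x v"
proof -
  have "v$1 * phiF_x 1 x v + v$2 * phiF_x 2 x v =
      (1 - rK\<^sup>2) * (4 * (x \<bullet> v) * norm_sq v - 2 * (x \<bullet> v) * norm_sq v) / (gapK x * (gap1 x)\<^sup>2)
     + phiF x v * (2 * (x \<bullet> v) / gapK x + 4 * (x \<bullet> v) / gap1 x)"
    by (simp add: phiF_x_def norm_sq_alt inner_vec_2 add_divide_distrib diff_divide_distrib algebra_simps)
  also have "\<dots> = psiF x v + 4 * projK x v * phiF x v"
    using gapK_pos[OF assms] gap1_pos[OF assms]
    by (simp add: psiF_def projK_def phiF_def divide_simps) algebra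
  finally show ?thesis .
qed

lemma phiF_vx_contract:
  "v$1 * phiF_vx k 1 x v + v$2 * phiF_vx k 2 x v =
     (1 - rK\<^sup>2) * (4 * norm_sq v * x$k) / (gapK x * (gap1 x)\<^sup>2) + phiF_v k x v * (2 * (x \<bullet> v) / gapK x + 4 * (x \<bullet> v) / gap1 x)"
proof -
  have k: "v$1 * kron k 1 + v$2 * kron k 2 = v$k" using exhaust_2[of k] by (auto simp: kron_def)
  have "v$1 * phiF_vx k 1 x v + v$2 * phiF_vx k 2 x v =
     (1 - rK\<^sup>2) * (4 * norm_sq v * x$k - 4 * (x \<bullet> v) * v$k + 4 * (x \<bullet> v) * (v$1 * kron k 1 + v$2 * kron k 2)) / (gapK x * (gap1 x)\<^sup>2)
      + phiF_v k x v * (2 * (x \<bullet> v) / gapK x + 4 * (x \<bullet> v) / gap1 x)"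
    by (simp add: phiF_vx_def norm_sq_alt inner_vec_2 add_divide_distrib diff_divide_distrib algebra_simps)
  then show ?thesis unfolding k by simp
qed

text \<open>The left-hand side is an antisymmetrised second covariant derivative of \<open>\<beta>\<close> along \<open>\<xi>\<close>; by the
  Ricci identity it is a curvature term of \<open>\<alpha>\<close>, and it becomes \<open>F \<tau>\<^sub>k\<close>.\<close>

lemma phiF_ricci_identity:
  assumes "slit_tangent x v"
  shows "phiF_x k x v - (v$1 * phiF_vx k 1 x v + v$2 * phiF_vx k 2 x v) / 2 - phiF x v * (x$k / gapK x)
    + projK x v * phiF_v k x v / 2 = (1 - rK\<^sup>2) * (x$k * norm_sq v - v$k * (x \<bullet> v)) / ((gapK x)\<^sup>2 * gap1 x)"
  unfolding phiF_vx_contract phiF_x_def phiF_v_def phiF_def projK_def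
  using gapK_pos[OF assms] gap1_pos[OF assms] by (simp add: divide_simps) algebra

text \<open>For \<open>projK\<close> alone the left side is minus the square of \<alpha>, reflecting
  curvature -1 of the Klein metric. With \<open>projF = projK + q\<close> the mixed terms
  \<open>projK * q\<close> cancel, and the square and the derivative of F together contribute
  \<open>3 * q^2\<close>.\<close>

lemma projF_x_contract:
  assumes "slit_tangent x v"
  shows "(projF x v)\<^sup>2 - (v$1 * projF_x 1 x v + v$2 * projF_x 2 x v)
    = 3 * (phiF x v / (2 * FF x v))\<^sup>2 - psiF x v / (2 * FF x v) - (alphaF x v)\<^sup>2"
proof -
  define q where "q = phiF x v / (2 * FF x v)"
  have q: "phiF x v = 2 * q * FF x v" using FF_pos[OF assms] by (simp add: q_def)
  have "v$1 * projF_x 1 x v + v$2 * projF_x 2 x v = norm_sq v / gapK x + 2 * (projK x v)\<^sup>2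
     + (v$1 * phiF_x 1 x v + v$2 * phiF_x 2 x v) / (2 * FF x v)
     - phiF x v * (v$1 * FF_x 1 x v + v$2 * FF_x 2 x v) / (2 * (FF x v)\<^sup>2)"
    by (simp add: projF_x_def norm_sq_alt projK_def inner_vec_2 add_divide_distrib power2_eq_square algebra_simps)
  also have "\<dots> = norm_sq v / gapK x + 2 * (projK x v)\<^sup>2 + psiF x v / (2 * FF x v) + 4 * projK x v * q - 2 * q * projF x v"
    unfolding phiF_x_contract[OF assms] FF_x_contract[OF assms] q
    using FF_pos[OF assms] by (simp add: field_simps power2_eq_square)
  finally have "v$1 * projF_x 1 x v + v$2 * projF_x 2 x v = \<dots>" .
  moreover have "(alphaF x v)\<^sup>2 = norm_sq v / gapK x + (projK x v)\<^sup>2"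
    using gapK_pos[OF assms] unfolding alphaF_sq[OF assms] projK_def norm_sq_def
    by (simp add: field_simps power2_eq_square)
  moreover have "projF x v = projK x v + q" by (simp add: projF_def q_def)
  ultimately show ?thesis unfolding q_def[symmetric] by (simp add: algebra_simps power2_eq_square)
qed

lemma projF_vx_contract:
  assumes "slit_tangent x v"
  shows "2 * projF_x k x v - (v$1 * projF_vx k 1 x v + v$2 * projF_vx k 2 x v) - projF x v * projF_v k x v
    = alphaF x v * alphaF_v k x v
      - (3 * (phiF x v / (2 * FF x v))\<^sup>2 - psiF x v / (2 * FF x v)) * (FF_v k x v / FF x v)
      + (1 - rK\<^sup>2) * (x$k * norm_sq v - v$k * (x \<bullet> v)) / (FF x v * (gapK x)\<^sup>2 * gap1 x)"
proof -
  \<comment> \<open>\<open>T\<close> is F times the \<tau> of the theorem, the right side of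
    \<open>phiF_ricci_identity\<close>.\<close>
  define T where "T = (1 - rK\<^sup>2) * (x$k * norm_sq v - v$k * (x \<bullet> v)) / ((gapK x)\<^sup>2 * gap1 x)"
  define W where "W = v$1 * phiF_vx k 1 x v + v$2 * phiF_vx k 2 x v"
  note F = FF_pos[OF assms]
  have k: "v$1 * kron k 1 + v$2 * kron k 2 = v$k" using exhaust_2[of k] by (auto simp: kron_def)
  have "v$1 * projF_vx k 1 x v + v$2 * projF_vx k 2 x v =
      (v$1 * kron k 1 + v$2 * kron k 2) / gapK x + 2 * x$k * (x \<bullet> v) / (gapK x)\<^sup>2 + W / (2 * FF x v)
     - (phiF_v k x v * (v$1 * FF_x 1 x v + v$2 * FF_x 2 x v) + (v$1 * phiF_x 1 x v + v$2 * phiF_x 2 x v) * FF_v k x v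
       + phiF x v * (v$1 * FF_vx k 1 x v + v$2 * FF_vx k 2 x v)) / (2 * (FF x v)\<^sup>2)
     + phiF x v * FF_v k x v * (v$1 * FF_x 1 x v + v$2 * FF_x 2 x v) / (FF x v)^3"
    by (simp add: projF_vx_def W_def inner_vec_2 add_divide_distrib algebra_simps)
  then have 1: "v$1 * projF_vx k 1 x v + v$2 * projF_vx k 2 x v =
      v$k / gapK x + 2 * x$k * (x \<bullet> v) / (gapK x)\<^sup>2 + W / (2 * FF x v)
     - (phiF_v k x v * (2 * projF x v * FF x v) + (psiF x v + 4 * projK x v * phiF x v) * FF_v k x v
       + phiF x v * FF_x k x v) / (2 * (FF x v)\<^sup>2)
     + phiF x v * FF_v k x v * (2 * projF x v * FF x v) / (FF x v)^3"
    unfolding k FF_x_contract[OF assms] phiF_x_contract[OF assms] FF_vx_euler_right[OF assms] .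
  have 2: "phiF_x k x v = T + W / 2 + phiF x v * (x$k / gapK x) - projK x v * phiF_v k x v / 2"
    using phiF_ricci_identity[OF assms, of k] by (simp add: T_def W_def)
  \<comment> \<open>This is the part of the expression coming from \<open>projK\<close>
    alone.\<close>
  have 3: "v$k / gapK x + 2 * (x \<bullet> v) * x$k / (gapK x)\<^sup>2 - projK x v * (x$k / gapK x) = alphaF x v * alphaF_v k x v"
    using alphaF_pos[OF assms] gapK_pos[OF assms] by (simp add: alphaF_v_def projK_def field_simps power2_eq_square)
  \<comment> \<open>The remaining part, with free real variables: \<open>F'\<close>,
    \<open>f1\<close> and \<open>p'\<close> are the \<open>v^k\<close>-derivatives of
    \<open>F\<close>, \<open>f\<close> (\<open>phiF\<close>) and \<open>p\<close>
    (\<open>projK\<close>), \<open>f'\<close> is the \<open>x^k\<close>-derivative of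
    \<open>f\<close>, \<open>h\<close> is \<open>psiF\<close> and \<open>w\<close> is
    \<open>W\<close>. The central identity has already replaced \<open>FF_x\<close>, so only a
    rational identity is left.\<close>
  have 4: "2 * (f' / (2 * F) - f * (p' * F + p * F' + f1 / 2) / (2 * F\<^sup>2))
     - (w / (2 * F) - (f1 * (2 * (p + f / (2 * F)) * F) + (h + 4 * p * f) * F' + f * (p' * F + p * F' + f1 / 2)) / (2 * F\<^sup>2)
         + f * F' * (2 * (p + f / (2 * F)) * F) / F^3)
     - (p * (f1 / (2 * F) - f * F' / (2 * F\<^sup>2)) + f / (2 * F) * (p' + f1 / (2 * F) - f * F' / (2 * F\<^sup>2)))
     = T / F - (3 * (f / (2 * F))\<^sup>2 - h / (2 * F)) * (F' / F)"
    if "F \<noteq> 0" "f' = T + w / 2 + f * p' - p * f1 / 2" for F F' f f' f1 p p' w h T :: real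
    unfolding that(2) using that(1) by (simp add: divide_simps) algebra
  have "2 * projF_x k x v - (v$1 * projF_vx k 1 x v + v$2 * projF_vx k 2 x v) - projF x v * projF_v k x v
    = alphaF x v * alphaF_v k x v + (T / FF x v -
       (3 * (phiF x v / (2 * FF x v))\<^sup>2 - psiF x v / (2 * FF x v)) * (FF_v k x v / FF x v))"
    unfolding 3[symmetric] 4[OF less_imp_neq[OF F, symmetric] 2, symmetric] 1 projF_x_def projF_v_def
    unfolding FF_x_def projF_def by (simp add: algebra_simps add_divide_distrib)
  then show ?thesis by (simp add: T_def mult.assoc)
qed

theorem theorem4p2:
  fixes x v :: "real^2"
  assumes "norm x < rK" and "v \<noteq> 0"
  defines "\<phi> \<equiv> (1 - rK^2) * ((1 - (norm x)^2) * (norm v)^2 + 2 * (x \<bullet> v)^2)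
                 / ((rK^2 - (norm x)^2) * (1 - (norm x)^2)^2)"
    and "\<psi> \<equiv> 2 * (1 - rK^2) * (x \<bullet> v) / ((1 - (norm x)^2)^3 * (rK^2 - (norm x)^2)^2)
              * ((1 - (norm x)^2) * (norm v)^2 * (3 * rK^2 - 2 * (norm x)^2 - 1)
                 - 2 * (x \<bullet> v)^2 * (1 + (norm x)^2 - 2 * rK^2))"
    and "\<tau> \<equiv> \<lambda>k. (1 - rK^2) * (x $ k * (norm v)^2 - v $ k * (x \<bullet> v))
              / (FF x v * (rK^2 - (norm x)^2)^2 * (1 - (norm x)^2))"
  shows "(\<forall>i k. riemann FF i k x v =
            - ((if i = k then 1 else 0) * (alphaF x v)^2 - alphaF x v * pdxi k alphaF x v * v $ i)
            + (3 * (\<phi> / (2 * FF x v))^2 - \<psi> / (2 * FF x v))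
              * ((if i = k then 1 else 0) - pdxi k FF x v / FF x v * v $ i)
            + \<tau> k * v $ i)
       \<and> ricci FF x v = 3 * (\<phi> / (2 * FF x v))^2 - \<psi> / (2 * FF x v) - (alphaF x v)^2
       \<and> flag_curv FF x v * (FF x v)^2 = 3 * (\<phi> / (2 * FF x v))^2 - \<psi> / (2 * FF x v) - (alphaF x v)^2"
proof -
  have T: "slit_tangent x v" using assms(1,2) by (simp add: slit_tangent_def)
  define B where "B = 3 * (\<phi> / (2 * FF x v))\<^sup>2 - \<psi> / (2 * FF x v)"
  have phi: "\<phi> = phiF x v" by (simp add: \<phi>_def phiF_def gapK_def gap1_def norm_sq_def)
  have psi: "\<psi> = psiF x v"
    unfolding \<psi>_def psiF_def gapK_def gap1_def norm_sq_def by (simp add: algebra_simps)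
  have tau: "\<tau> k = (1 - rK\<^sup>2) * (x$k * norm_sq v - v$k * (x \<bullet> v)) / (FF x v * (gapK x)\<^sup>2 * gap1 x)" for k
    by (simp add: \<tau>_def gapK_def gap1_def norm_sq_def)
  have d: "pdxi k alphaF x v = alphaF_v k x v" "pdxi k FF x v = FF_v k x v" for k
    using alphaF_pdxi[OF T] FF_pdxi[OF T] by (auto intro: pdxi_eqI)
  have R: "riemann FF i k x v = kron i k * (B - (alphaF x v)\<^sup>2)
      + v$i * (alphaF x v * alphaF_v k x v - B * (FF_v k x v / FF x v) + \<tau> k)" for i k
    unfolding riemann_projectively_flat[OF T] projF_x_contract[OF T] projF_vx_contract[OF T]
      B_def phi psi tau ..
  have "v$1 * \<tau> 1 + v$2 * \<tau> 2 = 0"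
    by (simp add: tau norm_sq_alt inner_vec_2 add_divide_distrib[symmetric]) (simp add: algebra_simps)
  \<comment> \<open>The Kronecker terms have trace twice \<open>B - (alphaF x v)^2\<close>; Euler's
    relations turn the next two terms into minus this quantity, and \<tau> contracts to zero with
    \<open>v\<close>.\<close>
  moreover have "ricci FF x v = 2 * (B - (alphaF x v)\<^sup>2)
      + alphaF x v * (v$1 * alphaF_v 1 x v + v$2 * alphaF_v 2 x v)
      - B * ((v$1 * FF_v 1 x v + v$2 * FF_v 2 x v) / FF x v) + (v$1 * \<tau> 1 + v$2 * \<tau> 2)"
    by (simp add: ricci_def sum_2 R kron_def add_divide_distrib algebra_simps)
  ultimately have Ric: "ricci FF x v = B - (alphaF x v)\<^sup>2"
    unfolding alphaF_v_euler[OF T] FF_v_euler[OF T] using FF_pos[OF T] by (simp add: power2_eq_square)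
  have "flag_curv FF x v * (FF x v)\<^sup>2 = ricci FF x v"
    using FF_pos[OF T] by (simp add: flag_curv_def)
  then show ?thesis
    unfolding B_def[symmetric] d Ric R kron_def by (simp add: algebra_simps)
qed

end
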